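(* If $\mathcal{G}$ and $\mathcal{G}'$ are two HR-equivalent ribbon graphs with half-ribbons, then $\mathcal{R}_{\mathcal{G}}=\mathcal{R}_{\mathcal{G}'}$.
   Context: A ribbon graph is a (not necessarily orientable) surface with boundary written as the union of two finite sets of closed discs, vertices $\mathcal{V}$ and edges $\mathcal{E}$, such that vertices and edges meet in disjoint line segments, each segment lies on the boundary of precisely one vertex and one edge, and each edge contains exactly two such segments. A half-ribbon (HR) is a rectangle attached to a unique vertex along one side; the opposite side is its external segment, whose two end points are its external points. A ribbon graph with HRs $\mathcal{G}(\mathcal{V},\mathcal{E},\mathfrak{f}^0)$ is a ribbon graph with a finite set $\mathfrak{f}^0$ of HRs attached to vertices along segments disjoint from each other and from those of the edges. The cut $\mathcal{G}\vee e$ of an edge $e$ is obtained by deleting $e$ and attaching two HRs at the two segments where $e$ was attached. A spanning c-subgraph $A\Subset\mathcal{G}$ is obtained by cutting all edges of some subset of $\mathcal{E}$; $\mathcal{E}(A)$ is the set of uncut edges. A closed face is a boundary component of the surface which passes through no external segment of a HR; $F_{\mathrm{int}}$ is the number of closed faces. An open face is a boundary arc going from an external point of a HR to another external point without passing through an external segment. The boundary graph has one vertex per HR and one edge per open face, an edge being incident to the HR(s) containing the ends of the open face; $C_\partial$ is the number of its connected components (the "boundary connected components"). HR moves: a HR move removes a HR $f$ from its vertex and reattaches it on the same or another vertex so that it is either (a) a displacement: the boundary connected component to which $f$ belongs is not modified ($f$ is moved within the same boundary component); or (b) a jump: $f$ is moved from one boundary connected component to another existing one, provided the former remains a boundary connected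 component (it still contains at least one HR). Two ribbon graphs with HRs are HR-equivalent if they are related by a sequence of HR moves. For $A\Subset\mathcal{G}$: $k(A)$ is the number of connected components, $\mathrm{r}(A)=|\mathcal{V}|-k(A)$, $n(A)=|\mathcal{E}(A)|-\mathrm{r}(A)$, $t(A)=0$ if $A$ is orientable as a surface and $1$ otherwise, $f(A)$ is the number of HRs of $A$. The polynomial is $$\mathcal{R}_{\mathcal{G}}(X,Y,Z,S,W,T)=\sum_{A\Subset\mathcal{G}}(X-1)^{\mathrm{r}(\mathcal{G})-\mathrm{r}(A)}(Y-1)^{n(A)}Z^{k(A)-F_{\mathrm{int}}(A)+n(A)}S^{C_\partial(A)}W^{t(A)}T^{f(A)}$$ in the quotient of $\mathbb{Z}[X,Y,Z,S,W,T]$ by the ideal generated by $W^2-W$. *)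

theory Defs
  imports "HOL-Library.Poly_Mapping"
begin

section \<open>Ribbon graphs with half-ribbons\<close>

text \<open>
  A ribbon graph with half-ribbons (HRs) is recorded by its gluing data, which determine the surface,
  with its decomposition into discs, up to homeomorphism.  The elements of type 's are the attaching
  segments: the pairwise disjoint line segments on the boundary circles of the vertex discs along
  which edges and HRs are glued.  Every vertex disc carries a reference direction of its boundary
  circle.

  \<^item> \<open>vert_of s\<close> is the vertex on whose boundary the segment \<open>s\<close> lies, and \<open>succ s\<close> is the segment
    met after \<open>s\<close> on that circle in the reference direction.
  \<^item> An edge is given by the set of the two segments it contains, a HR by its only attaching segment.
  \<^item> An edge is in \<open>twisted\<close> iff the edge disc does not match the reference directions of the
    discs at its two segments.

  Values of \<open>vert_of\<close>, \<open>succ\<close> and \<open>twisted\<close> outside the segments and edges have no meaning.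
\<close>

record ('v, 's) rgraph =
  verts :: "'v set"
  edges :: "'s set set"
  hrs :: "'s set"
  vert_of :: "'s \<Rightarrow> 'v"
  succ :: "'s \<Rightarrow> 's"
  twisted :: "'s set set"

definition segs :: "('v, 's) rgraph \<Rightarrow> 's set" where
  "segs G = hrs G \<union> \<Union> (edges G)"

text \<open>The last condition says that the segments on one vertex form a single cycle of \<open>succ\<close>, since
  the boundary of a disc is one circle.\<close>

definition ribbon_graph :: "('v, 's) rgraph \<Rightarrow> bool" where
  "ribbon_graph G \<longleftrightarrow>
     finite (verts G) \<and> finite (edges G) \<and> finite (hrs G) \<and>
     (\<forall>e\<in>edges G. card e = 2) \<and>
     (\<forall>e\<in>edges G. \<forall>e'\<in>edges G. e \<noteq> e' \<longrightarrow> e \<inter> e' = {}) \<and>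
     (\<forall>e\<in>edges G. e \<inter> hrs G = {}) \<and>
     (\<forall>s\<in>segs G. vert_of G s \<in> verts G) \<and>
     bij_betw (succ G) (segs G) (segs G) \<and>
     (\<forall>s\<in>segs G. vert_of G (succ G s) = vert_of G s) \<and>
     (\<forall>s\<in>segs G. \<forall>t\<in>segs G. vert_of G s = vert_of G t \<longrightarrow> (\<exists>n. (succ G ^^ n) s = t))"

text \<open>The same ribbon graph has several presentations: \<open>f\<close> and \<open>g\<close> rename vertices and segments,
  and \<open>r\<close> says at which vertices the reference direction is reversed.  Ribbon graphs are considered
  up to this relation, i.e. up to homeomorphisms that respect vertices, edges and HRs.\<close>

definition rg_iso :: "('v, 's) rgraph \<Rightarrow> ('w, 't) rgraph \<Rightarrow> bool" where
  "rg_iso G H \<longleftrightarrow> ribbon_graph G \<and> ribbon_graph H \<and>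
     (\<exists>f g r. bij_betw f (verts G) (verts H) \<and> bij_betw g (segs G) (segs H) \<and>
        edges H = (\<lambda>e. g ` e) ` edges G \<and> hrs H = g ` hrs G \<and>
        (\<forall>s\<in>segs G. vert_of H (g s) = f (vert_of G s)) \<and>
        (\<forall>s\<in>segs G. if r (vert_of G s) then succ H (g (succ G s)) = g s
                                     else succ H (g s) = g (succ G s)) \<and>
        (\<forall>a b. {a, b} \<in> edges G \<longrightarrow>
           (g ` {a, b} \<in> twisted H \<longleftrightarrow>
              (({a, b} \<in> twisted G) \<noteq> (r (vert_of G a) \<noteq> r (vert_of G b))))))"

text \<open>Cutting a set of edges: the two segments of a cut edge become the segments of two new HRs.\<close>

definition cut :: "'s set set \<Rightarrow> ('v, 's) rgraph \<Rightarrow> ('v, 's) rgraph" where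
  "cut C G = G\<lparr>edges := edges G - C, hrs := hrs G \<union> \<Union> C\<rparr>"

definition spanning_c_subgraphs :: "('v, 's) rgraph \<Rightarrow> ('v, 's) rgraph set" where
  "spanning_c_subgraphs G = {cut C G | C. C \<subseteq> edges G}"


section \<open>Faces and boundary\<close>

definition components :: "'a set \<Rightarrow> ('a \<times> 'a) set \<Rightarrow> 'a set set" where
  "components A r = A // (r \<union> r\<inverse>)\<^sup>*"

text \<open>
  Points on the boundary: \<open>End s False\<close> and \<open>End s True\<close> are the first and the last end point of the
  segment \<open>s\<close> in the reference direction.  For a HR they also stand for the external points lying
  on the same sides of the rectangle.  \<open>Circle v\<close> represents the boundary circle of a vertex \<open>v\<close>
  that has no segments.
\<close>

datatype ('v, 's) bpoint = End 's bool | Circle 'v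

definition bare :: "('v, 's) rgraph \<Rightarrow> 'v \<Rightarrow> bool" where
  "bare G v \<longleftrightarrow> v \<in> verts G \<and> (\<forall>s\<in>segs G. vert_of G s \<noteq> v)"

definition bpoints :: "('v, 's) rgraph \<Rightarrow> ('v, 's) bpoint set" where
  "bpoints G = {End s x | s x. s \<in> segs G} \<union> {Circle v | v. bare G v}"

text \<open>The pieces of boundary: the arcs of the vertex circles between consecutive segments, the two
  free sides of each edge, and the external segments of the HRs.\<close>

definition vertex_arcs :: "('v, 's) rgraph \<Rightarrow> (('v, 's) bpoint \<times> ('v, 's) bpoint) set" where
  "vertex_arcs G = {(End s True, End (succ G s) False) | s. s \<in> segs G}"

definition edge_sides :: "('v, 's) rgraph \<Rightarrow> (('v, 's) bpoint \<times> ('v, 's) bpoint) set" where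
  "edge_sides G = {(End a x, End b y) | a b x y.
     {a, b} \<in> edges G \<and> a \<noteq> b \<and> (if {a, b} \<in> twisted G then x = y else x \<noteq> y)}"

definition external_segments :: "('v, 's) rgraph \<Rightarrow> (('v, 's) bpoint \<times> ('v, 's) bpoint) set" where
  "external_segments G = {(End h False, End h True) | h. h \<in> hrs G}"

definition boundary_rel :: "('v, 's) rgraph \<Rightarrow> (('v, 's) bpoint \<times> ('v, 's) bpoint) set" where
  "boundary_rel G = vertex_arcs G \<union> edge_sides G \<union> external_segments G"

text \<open>The connected components of the boundary of the surface, as sets of boundary points.\<close>

definition boundary_circles :: "('v, 's) rgraph \<Rightarrow> ('v, 's) bpoint set set" where
  "boundary_circles G = components (bpoints G) (boundary_rel G)"

definition meets_hr :: "('v, 's) rgraph \<Rightarrow> ('v, 's) bpoint set \<Rightarrow> bool" where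
  "meets_hr G c \<longleftrightarrow> (\<exists>h\<in>hrs G. \<exists>x. End h x \<in> c)"

definition closed_faces :: "('v, 's) rgraph \<Rightarrow> ('v, 's) bpoint set set" where
  "closed_faces G = {c \<in> boundary_circles G. \<not> meets_hr G c}"

definition open_faces :: "('v, 's) rgraph \<Rightarrow> ('v, 's) bpoint set set" where
  "open_faces G = {c \<in> components (bpoints G) (vertex_arcs G \<union> edge_sides G). meets_hr G c}"

text \<open>Adjacency in the boundary graph, whose vertices are the HRs and whose edges are the open
  faces.\<close>

definition boundary_graph :: "('v, 's) rgraph \<Rightarrow> ('s \<times> 's) set" where
  "boundary_graph G = {(h, h'). h \<in> hrs G \<and> h' \<in> hrs G \<and>
     (\<exists>c\<in>open_faces G. \<exists>x y. End h x \<in> c \<and> End h' y \<in> c)}"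


section \<open>HR moves\<close>

text \<open>\<open>hr_attached G f p G'\<close>: \<open>G'\<close> is obtained from \<open>G\<close> by attaching a new HR \<open>f\<close>, either on the arc
  of a vertex circle that starts at \<open>p = End s True\<close>, or on the circle \<open>p = Circle v\<close> of a vertex
  without segments.\<close>

inductive hr_attached ::
    "('v, 's) rgraph \<Rightarrow> 's \<Rightarrow> ('v, 's) bpoint \<Rightarrow> ('v, 's) rgraph \<Rightarrow> bool" where
  on_arc: "s \<in> segs G \<Longrightarrow> f \<notin> segs G \<Longrightarrow>
     hr_attached G f (End s True)
       (G\<lparr>hrs := insert f (hrs G), vert_of := (vert_of G)(f := vert_of G s),
          succ := (succ G)(f := succ G s, s := f)\<rparr>)"
| on_circle: "bare G v \<Longrightarrow> f \<notin> segs G \<Longrightarrow>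
     hr_attached G f (Circle v)
       (G\<lparr>hrs := insert f (hrs G), vert_of := (vert_of G)(f := v), succ := (succ G)(f := f)\<rparr>)"

text \<open>
  In both moves \<open>H\<close> is the ribbon graph from which \<open>f\<close> has been removed, and \<open>c\<close>, \<open>d\<close> are the
  boundary components of \<open>H\<close> on which \<open>f\<close> was and on which it is reattached.  The boundary
  connected components, i.e. the components of the boundary graph, correspond to the boundary
  components of the surface that pass through a HR.
\<close>

definition displacement :: "('v, 's) rgraph \<Rightarrow> ('v, 's) rgraph \<Rightarrow> bool" where
  "displacement G G' \<longleftrightarrow> (\<exists>H f p q. ribbon_graph H \<and> hr_attached H f p G \<and> hr_attached H f q G' \<and>
     (\<exists>c\<in>boundary_circles H. p \<in> c \<and> q \<in> c))"

definition jump :: "('v, 's) rgraph \<Rightarrow> ('v, 's) rgraph \<Rightarrow> bool" where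
  "jump G G' \<longleftrightarrow> (\<exists>H f p q. ribbon_graph H \<and> hr_attached H f p G \<and> hr_attached H f q G' \<and>
     (\<exists>c\<in>boundary_circles H. \<exists>d\<in>boundary_circles H.
        p \<in> c \<and> q \<in> d \<and> c \<noteq> d \<and> meets_hr H c \<and> meets_hr H d))"

definition hr_move :: "('v, 's) rgraph \<Rightarrow> ('v, 's) rgraph \<Rightarrow> bool" where
  "hr_move G G' \<longleftrightarrow> displacement G G' \<or> jump G G'"

text \<open>The result of a sequence of HR moves is taken up to \<open>rg_iso\<close>, so that the relation does not
  depend on the chosen presentations.\<close>

definition hr_equivalent :: "('v, 's) rgraph \<Rightarrow> ('w, 't) rgraph \<Rightarrow> bool" where
  "hr_equivalent G G' \<longleftrightarrow> (\<exists>K. hr_move\<^sup>*\<^sup>* G K \<and> rg_iso K G')"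


section \<open>The polynomial\<close>

text \<open>Every edge and every HR meets a vertex, so the connected components of the surface are those
  of the set of vertices under adjacency by an edge.\<close>

definition k_comp :: "('v, 's) rgraph \<Rightarrow> nat" where
  "k_comp G = card (components (verts G)
     {(vert_of G a, vert_of G b) | a b. {a, b} \<in> edges G})"

definition rank :: "('v, 's) rgraph \<Rightarrow> nat" where
  "rank G = card (verts G) - k_comp G"

definition nullity :: "('v, 's) rgraph \<Rightarrow> nat" where
  "nullity G = card (edges G) - rank G"

definition F_int :: "('v, 's) rgraph \<Rightarrow> nat" where
  "F_int G = card (closed_faces G)"

definition C_bd :: "('v, 's) rgraph \<Rightarrow> nat" where
  "C_bd G = card (components (hrs G) (boundary_graph G))"

text \<open>An orientation of the surface is a choice of orientation of all discs that is coherent along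
  the segments.  With \<open>d v\<close> telling whether \<open>v\<close> is oriented along its reference direction, the
  disc of an untwisted edge can be oriented coherently with both its ends iff \<open>d\<close> agrees at
  them, that of a twisted edge iff \<open>d\<close> differs.\<close>

definition orientable :: "('v, 's) rgraph \<Rightarrow> bool" where
  "orientable G \<longleftrightarrow> (\<exists>d :: 'v \<Rightarrow> bool. \<forall>a b. {a, b} \<in> edges G \<longrightarrow>
     ({a, b} \<in> twisted G \<longleftrightarrow> d (vert_of G a) \<noteq> d (vert_of G b)))"

definition t_inv :: "('v, 's) rgraph \<Rightarrow> nat" where
  "t_inv G = (if orientable G then 0 else 1)"

datatype indet = indX | indY | indZ | indS | indW | indT

text \<open>The ring of polynomials over the integers in the six indeterminates: finitely supported maps
  from monomials, which are finitely supported maps from indeterminates to exponents.\<close>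

type_synonym zpoly = "(indet \<Rightarrow>\<^sub>0 nat) \<Rightarrow>\<^sub>0 int"

definition Var :: "indet \<Rightarrow> zpoly" where
  "Var i = Poly_Mapping.single (Poly_Mapping.single i 1) 1"

text \<open>The truncated subtractions are harmless: rank and nullity are nonnegative,
  \<open>rank A \<le> rank G\<close>, and \<open>k(A) - F(A) + n(A) \<ge> 0\<close> where \<open>F(A) \<ge> F_int A\<close> is the number of all
  boundary components, because the Euler characteristic of the closed surface
  obtained by capping them off is at most \<open>2 k(A)\<close>.\<close>

definition R_poly :: "('v, 's) rgraph \<Rightarrow> zpoly" where
  "R_poly G = (\<Sum>A\<in>spanning_c_subgraphs G.
     (Var indX - 1) ^ (rank G - rank A) * (Var indY - 1) ^ nullity A *
     Var indZ ^ (k_comp A + nullity A - F_int A) * Var indS ^ C_bd A *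
     Var indW ^ t_inv A * Var indT ^ card (hrs A))"

text \<open>The polynomial lives in the quotient ring by the ideal generated by \<open>W\<^sup>2 - W\<close>; its elements are
  the cosets of that ideal.\<close>

definition ideal_W :: "zpoly set" where
  "ideal_W = {q * (Var indW ^ 2 - Var indW) | q. True}"

definition quotient_class :: "zpoly \<Rightarrow> zpoly set" where
  "quotient_class p = {p + i | i. i \<in> ideal_W}"

definition R :: "('v, 's) rgraph \<Rightarrow> zpoly set" where
  "R G = quotient_class (R_poly G)"

end

theory Submission
  imports Defs
begin

text \<open>
  Both kinds of HR move take a HR \<open>f\<close> off a ribbon graph and put it back elsewhere, so
  everything is compared with the ribbon graph \<open>H\<close> without \<open>f\<close>.  Cutting a set \<open>C\<close> of edges commutes
  with attaching \<open>f\<close>, and the spanning c-subgraphs before and after the move are matched by \<open>C\<close>.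
  For a fixed \<open>C\<close>, the numbers of vertices, edges and HRs, the connected components and
  orientability do not see where \<open>f\<close> is attached; only \<open>F_int\<close> and \<open>C_bd\<close> might.

  Attaching \<open>f\<close> at a point \<open>p\<close> of a ribbon graph \<open>K\<close> leaves the boundary circles as they are,
  except that the circle of \<open>p\<close> now passes through a HR.  Since the boundary connected components
  correspond to the boundary circles that meet a HR (\<open>C_bd_eq_circles\<close>), the only effect is that a
  closed face turns into a boundary connected component if the circle of \<open>p\<close> was a closed face, and
  nothing happens otherwise (\<open>hr_attached_F_int_C_bd\<close>).  With \<open>K = cut C H\<close>, what has to be shown is
  therefore that the circle of the old point \<open>p\<close> in \<open>cut C H\<close> is a closed face iff that of the new
  point \<open>q\<close> is.

  Cutting edges rearranges boundary circles, even splits and merges them, but whether the circle of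
  \<open>p\<close> in \<open>cut C H\<close> meets a HR can be read off from its circle in \<open>H\<close>: the answer is yes iff the
  latter meets a HR or a cut edge (\<open>meets_hr_cut_iff\<close>).  Indeed the walk from \<open>p\<close> along the boundary
  is the same in both until it first reaches a HR or a cut edge.  In a displacement \<open>p\<close> and \<open>q\<close> lie on the
  same circle of \<open>H\<close>, in a jump both circles meet a HR of \<open>H\<close>, so the answers agree.

  Finally the polynomial is unchanged by renaming vertices and segments and reversing reference
  directions, because all the numbers that enter it are.
\<close>

section \<open>Connected components of a relation\<close>

abbreviation conn :: "('a \<times> 'a) set \<Rightarrow> ('a \<times> 'a) set" where
  "conn r \<equiv> (r \<union> r\<inverse>)\<^sup>*"

lemma conn_sym: "(x, y) \<in> conn r \<Longrightarrow> (y, x) \<in> conn r"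
proof -
  have "sym (r \<union> r\<inverse>)" by (auto simp: sym_def)
  then show "(x, y) \<in> conn r \<Longrightarrow> (y, x) \<in> conn r"
    by (meson symD sym_rtrancl)
qed

lemma conn_step: "(x, y) \<in> r \<union> r\<inverse> \<Longrightarrow> (x, y) \<in> conn r"
  by (rule r_into_rtrancl)

lemma conn_class_eq: "conn r `` {x} = conn r `` {y} \<longleftrightarrow> (x, y) \<in> conn r"
proof
  assume "conn r `` {x} = conn r `` {y}"
  then have "y \<in> conn r `` {x}" by simp
  then show "(x, y) \<in> conn r" by simp
next
  assume xy: "(x, y) \<in> conn r"
  show "conn r `` {x} = conn r `` {y}"
    using rtrancl_trans[OF xy] rtrancl_trans[OF conn_sym[OF xy]] by (auto simp del: rtrancl_Un_rtrancl)
qed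

lemma conn_map:
  assumes "(x, y) \<in> conn r" and "\<And>x y. (x, y) \<in> r \<Longrightarrow> (h x, h y) \<in> conn s"
  shows "(h x, h y) \<in> conn s"
  using assms(1)
proof (induction rule: rtrancl_induct)
  case (step y z)
  then have "(y, z) \<in> r \<or> (z, y) \<in> r" by simp
  then have "(h y, h z) \<in> conn s"
    using assms(2)[of y z] conn_sym[OF assms(2)[of z y]] by argo
  with step.IH show ?case by (rule rtrancl_trans)
qed simp

lemma card_image_same_kernel:
  assumes "\<And>x y. x \<in> A \<Longrightarrow> y \<in> A \<Longrightarrow> f x = f y \<longleftrightarrow> g x = g y"
  shows "card (f ` A) = card (g ` A)"
proof (rule bij_betw_same_card)
  let ?h = "\<lambda>c. g (inv_into A f c)"
  have h: "?h (f a) = g a" if "a \<in> A" for a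
    using assms[of "inv_into A f (f a)" a] that
    by (simp add: inv_into_into f_inv_into_f)
  show "bij_betw ?h (f ` A) (g ` A)"
    unfolding bij_betw_def
  proof
    show "inj_on ?h (f ` A)"
    proof (rule inj_onI, elim imageE)
      fix c d x y assume *: "?h c = ?h d" "c = f x" "x \<in> A" "d = f y" "y \<in> A"
      then have "g x = g y" using h by simp
      then show "c = d" using assms * by simp
    qed
    show "?h ` f ` A = g ` A"
      unfolding image_image by (rule image_cong[OF refl h])
  qed
qed

lemma conn_iff_transfer:
  assumes r: "\<And>x y. (x, y) \<in> r \<Longrightarrow> (\<pi> x, \<pi> y) \<in> conn s"
    and s: "\<And>x y. (x, y) \<in> s \<Longrightarrow> (\<sigma> x, \<sigma> y) \<in> conn r"
    and "(x, \<sigma> (\<pi> x)) \<in> conn r" and "(y, \<sigma> (\<pi> y)) \<in> conn r"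
  shows "(x, y) \<in> conn r \<longleftrightarrow> (\<pi> x, \<pi> y) \<in> conn s"
proof
  assume "(\<pi> x, \<pi> y) \<in> conn s"
  then have "(\<sigma> (\<pi> x), \<sigma> (\<pi> y)) \<in> conn r" by (rule conn_map[where h = \<sigma>]) (rule s)
  with assms(3) have "(x, \<sigma> (\<pi> y)) \<in> conn r" by (rule rtrancl_trans)
  then show "(x, y) \<in> conn r" using conn_sym[OF assms(4)] by (rule rtrancl_trans)
qed (erule conn_map[where h = \<pi>], rule r)

text \<open>Two relations have equally many components when there are maps in both directions that
  preserve connectedness and are inverse to each other up to connectedness.  Marked sets \<open>M\<close>, \<open>N\<close>
  are carried along, so that the components with and those without a mark can be counted
  separately; for boundary circles the marks are the points on HRs.\<close>

lemma component_count_transfer: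
  assumes r: "\<And>x y. (x, y) \<in> r \<Longrightarrow> (\<pi> x, \<pi> y) \<in> conn s"
    and s: "\<And>x y. (x, y) \<in> s \<Longrightarrow> (\<sigma> x, \<sigma> y) \<in> conn r"
    and A: "\<And>x. x \<in> A \<Longrightarrow> \<pi> x \<in> B \<and> (x, \<sigma> (\<pi> x)) \<in> conn r"
    and B: "\<And>y. y \<in> B \<Longrightarrow> \<sigma> y \<in> A \<and> \<pi> (\<sigma> y) = y"
    and M: "M \<subseteq> A" and N: "N = \<pi> ` M"
  shows "card {c \<in> components A r. (c \<inter> M = {}) = b} = card {c \<in> components B s. (c \<inter> N = {}) = b}"
proof -
  let ?cr = "\<lambda>x. conn r `` {x}" and ?cs = "\<lambda>y. conn s `` {y}"
  have iff: "(x, y) \<in> conn r \<longleftrightarrow> (\<pi> x, \<pi> y) \<in> conn s" if "x \<in> A" "y \<in> A" for x y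
    by (rule conn_iff_transfer[where \<sigma> = \<sigma>]) (use r s A that in auto)
  have marks: "?cr x \<inter> M = {} \<longleftrightarrow> ?cs (\<pi> x) \<inter> N = {}" if "x \<in> A" for x
    using iff[OF that] M unfolding N by blast
  let ?A = "{x \<in> A. (?cr x \<inter> M = {}) = b}" and ?B = "{y \<in> B. (?cs y \<inter> N = {}) = b}"
  have "?B = \<pi> ` ?A"
  proof (intro equalityI subsetI)
    fix y assume y: "y \<in> ?B"
    then have "\<sigma> y \<in> ?A" "y = \<pi> (\<sigma> y)" using B[of y] marks[of "\<sigma> y"] by simp_all
    then show "y \<in> \<pi> ` ?A" by (rule rev_image_eqI)
  next
    fix y assume "y \<in> \<pi> ` ?A"
    then show "y \<in> ?B" using A marks by blast
  qed
  moreover have "{c \<in> components B s. (c \<inter> N = {}) = b} = ?cs ` ?B"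
    by (auto simp: components_def quotient_def)
  ultimately have "{c \<in> components B s. (c \<inter> N = {}) = b} = (\<lambda>x. ?cs (\<pi> x)) ` ?A"
    by (simp only: image_image)
  moreover have "{c \<in> components A r. (c \<inter> M = {}) = b} = ?cr ` ?A"
    by (auto simp: components_def quotient_def)
  moreover have "card (?cr ` ?A) = card ((\<lambda>x. ?cs (\<pi> x)) ` ?A)"
    by (rule card_image_same_kernel) (simp only: conn_class_eq mem_Collect_eq iff)
  ultimately show ?thesis by simp
qed

lemma component_count_bij:
  assumes bij: "bij_betw \<pi> A B"
    and r: "\<And>x y. (x, y) \<in> r \<Longrightarrow> (\<pi> x, \<pi> y) \<in> s \<union> s\<inverse>"
    and s: "\<And>u v. (u, v) \<in> s \<Longrightarrow> \<exists>x\<in>A. \<exists>y\<in>A. (x, y) \<in> r \<union> r\<inverse> \<and> u = \<pi> x \<and> v = \<pi> y"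
    and M: "M \<subseteq> A" and N: "N = \<pi> ` M"
  shows "card {c \<in> components A r. (c \<inter> M = {}) = b} = card {c \<in> components B s. (c \<inter> N = {}) = b}"
proof (rule component_count_transfer[where \<pi> = \<pi> and \<sigma> = "inv_into A \<pi>"])
  have inj: "inj_on \<pi> A" using bij by (rule bij_betw_imp_inj_on)
  show "(\<pi> x, \<pi> y) \<in> conn s" if "(x, y) \<in> r" for x y
    using r[OF that] by (rule conn_step)
  show "(inv_into A \<pi> u, inv_into A \<pi> v) \<in> conn r" if "(u, v) \<in> s" for u v
  proof -
    from s[OF that] obtain x y where
      xy: "x \<in> A" "y \<in> A" "(x, y) \<in> r \<union> r\<inverse>" "u = \<pi> x" "v = \<pi> y" by blast
    show ?thesis
      unfolding xy(4,5) inv_into_f_f[OF inj xy(1)] inv_into_f_f[OF inj xy(2)]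
      by (rule conn_step) (rule xy(3))
  qed
  show "\<pi> x \<in> B \<and> (x, inv_into A \<pi> (\<pi> x)) \<in> conn r" if "x \<in> A" for x
    using bij_betwE[OF bij] inv_into_f_f[OF inj that] that by simp
  show "inv_into A \<pi> y \<in> A \<and> \<pi> (inv_into A \<pi> y) = y" if "y \<in> B" for y
  proof -
    have "y \<in> \<pi> ` A" using bij that by (simp add: bij_betw_def)
    then show ?thesis using inv_into_into f_inv_into_f by metis
  qed
qed (rule M, rule N)

text \<open>A path to \<open>M\<close> uses steps of \<open>s\<close> until it first leaves \<open>s\<close>, and by then it has reached \<open>M\<close>
  already.\<close>

lemma conn_reaches_mono:
  assumes "\<And>x y. (x, y) \<in> r - s \<Longrightarrow> x \<in> M \<and> y \<in> M"
    and "(p, m) \<in> conn r" and "m \<in> M"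
  shows "\<exists>m\<in>M. (p, m) \<in> conn s"
  using assms(2)
proof (induction rule: converse_rtrancl_induct)
  case base
  then show ?case using assms(3) by blast
next
  case (step x y)
  then show ?case
  proof (cases "(x, y) \<in> s \<union> s\<inverse>")
    case True
    then show ?thesis using step.IH by (meson converse_rtrancl_into_rtrancl)
  next
    case False
    then have "x \<in> M" using step.hyps(1) assms(1) by blast
    then show ?thesis by blast
  qed
qed

lemma conn_reaches_iff:
  assumes "\<And>x y. (x, y) \<in> r - s \<Longrightarrow> x \<in> M \<and> y \<in> M"
    and "\<And>x y. (x, y) \<in> s - r \<Longrightarrow> x \<in> M \<and> y \<in> M"
  shows "(\<exists>m\<in>M. (p, m) \<in> conn r) \<longleftrightarrow> (\<exists>m\<in>M. (p, m) \<in> conn s)"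
proof
  assume "\<exists>m\<in>M. (p, m) \<in> conn r"
  then show "\<exists>m\<in>M. (p, m) \<in> conn s" using conn_reaches_mono[OF assms(1)] by blast
next
  assume "\<exists>m\<in>M. (p, m) \<in> conn s"
  then show "\<exists>m\<in>M. (p, m) \<in> conn r" using conn_reaches_mono[OF assms(2)] by blast
qed


section \<open>Boundary connected components as boundary circles\<close>

lemma open_face_adjacent:
  assumes "h \<in> hrs G" and "h' \<in> hrs G"
    and "(End h x, End h' y) \<in> conn (vertex_arcs G \<union> edge_sides G)"
  shows "(h, h') \<in> boundary_graph G"
proof -
  let ?b = "vertex_arcs G \<union> edge_sides G"
  let ?c = "conn ?b `` {End h x}"
  have "?c \<in> components (bpoints G) ?b"
    using assms(1) unfolding components_def bpoints_def segs_def by (auto intro!: quotientI)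
  then have "?c \<in> open_faces G"
    using assms(1) by (auto simp: open_faces_def meets_hr_def)
  moreover have "End h x \<in> ?c" "End h' y \<in> ?c" using assms(3) by auto
  ultimately show ?thesis
    using assms(1,2) unfolding boundary_graph_def by blast
qed

text \<open>Walking along a boundary circle away from a HR, the last HR passed is joined to the first one
  by the open faces crossed so far, and the walk since then lies in a single open face.  This is the
  invariant that turns a stretch of boundary into a path of the boundary graph.\<close>

lemma boundary_circle_open_face:
  assumes "(End h x, z) \<in> conn (boundary_rel G)" and "h \<in> hrs G"
  shows "\<exists>h'\<in>hrs G. \<exists>y. (h, h') \<in> conn (boundary_graph G) \<and>
           (End h' y, z) \<in> conn (vertex_arcs G \<union> edge_sides G)"
  using assms(1)
proof (induction rule: rtrancl_induct)
  case base
  show ?case using assms(2) by blast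
next
  case (step z z')
  let ?b = "vertex_arcs G \<union> edge_sides G"
  from step.IH obtain h' y where h': "h' \<in> hrs G" "(h, h') \<in> conn (boundary_graph G)"
    "(End h' y, z) \<in> conn ?b" by blast
  show ?case
  proof (cases "(z, z') \<in> ?b \<union> ?b\<inverse>")
    case True
    then have "(End h' y, z') \<in> conn ?b" using h'(3) by (meson rtrancl.rtrancl_into_rtrancl)
    then show ?thesis using h' by blast
  next
    case False
    then have "(z, z') \<in> external_segments G \<union> (external_segments G)\<inverse>"
      using step.hyps(2) by (auto simp: boundary_rel_def)
    then obtain k u u' where k: "k \<in> hrs G" "z = End k u" "z' = End k u'"
      by (auto simp: external_segments_def)
    have "(h', k) \<in> boundary_graph G"
      using open_face_adjacent[OF h'(1) k(1)] h'(3) k(2) by blast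
    then have "(h', k) \<in> conn (boundary_graph G)" by (intro conn_step UnI1)
    with h'(2) have "(h, k) \<in> conn (boundary_graph G)" by (rule rtrancl_trans)
    then show ?thesis using k by blast
  qed
qed

lemma conn_mono: "r \<subseteq> s \<Longrightarrow> conn r \<subseteq> conn s"
  by (intro rtrancl_mono) blast

lemma external_conn: "h \<in> hrs G \<Longrightarrow> (End h x, End h y) \<in> conn (boundary_rel G)"
  by (cases x; cases y)
     (auto simp: boundary_rel_def external_segments_def intro!: r_into_rtrancl)

lemma boundary_graph_conn_iff:
  assumes "h \<in> hrs G" "h' \<in> hrs G"
  shows "(h, h') \<in> conn (boundary_graph G) \<longleftrightarrow>
           (End h x, End h' y) \<in> conn (boundary_rel G)"
proof
  let ?b = "vertex_arcs G \<union> edge_sides G"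
  have b: "conn ?b \<subseteq> conn (boundary_rel G)"
    by (rule conn_mono) (auto simp: boundary_rel_def)
  have st: "(End a False, End a' False) \<in> conn (boundary_rel G)"
    if aa': "(a, a') \<in> boundary_graph G" for a a'
  proof -
    obtain c u u' where c: "a \<in> hrs G" "a' \<in> hrs G" "c \<in> open_faces G" "End a u \<in> c" "End a' u' \<in> c"
      using aa' unfolding boundary_graph_def by blast
    then obtain w where "c = conn ?b `` {w}"
      by (auto simp: open_faces_def components_def elim!: quotientE)
    then have "(w, End a u) \<in> conn ?b" "(w, End a' u') \<in> conn ?b" using c by blast+
    then have "(End a u, End a' u') \<in> conn (boundary_rel G)"
      using b conn_sym[of w "End a u" ?b] by (blast intro: rtrancl_trans)
    then show ?thesis
      using external_conn[OF c(1), of False u] external_conn[OF c(2), of u' False]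
      by (blast intro: rtrancl_trans)
  qed
  have "(End h False, End h' False) \<in> conn (boundary_rel G)"
    if "(h, h') \<in> conn (boundary_graph G)"
    using that by (rule conn_map[where h = "\<lambda>a. End a False"]) (rule st)
  then show "(End h x, End h' y) \<in> conn (boundary_rel G)"
    if "(h, h') \<in> conn (boundary_graph G)"
    using that external_conn[OF assms(1), of x False] external_conn[OF assms(2), of False y]
    by (blast intro: rtrancl_trans)
next
  let ?b = "vertex_arcs G \<union> edge_sides G"
  assume "(End h x, End h' y) \<in> conn (boundary_rel G)"
  then obtain k u where k: "k \<in> hrs G" "(h, k) \<in> conn (boundary_graph G)"
      "(End k u, End h' y) \<in> conn ?b"
    using boundary_circle_open_face[OF _ assms(1)] by blast
  have "(k, h') \<in> boundary_graph G" using open_face_adjacent[OF k(1) assms(2) k(3)] .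
  then have "(k, h') \<in> conn (boundary_graph G)" by (intro conn_step UnI1)
  with k(2) show "(h, h') \<in> conn (boundary_graph G)" by (rule rtrancl_trans)
qed

text \<open>Each HR lies on one boundary circle because its two ends are joined by its external segment,
  and two HRs lie on the same circle iff the boundary graph connects them.\<close>

lemma C_bd_eq_circles: "C_bd G = card {c \<in> boundary_circles G. meets_hr G c}"
proof -
  let ?\<pi> = "\<lambda>h. conn (boundary_rel G) `` {End h False}"
  let ?g = "\<lambda>h. conn (boundary_graph G) `` {h}"
  have iff: "?g h = ?g h' \<longleftrightarrow> ?\<pi> h = ?\<pi> h'" if "h \<in> hrs G" "h' \<in> hrs G" for h h'
    unfolding conn_class_eq using boundary_graph_conn_iff[OF that] by blast
  have "{c \<in> boundary_circles G. meets_hr G c} = ?\<pi> ` hrs G" (is "?L = ?R")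
  proof (intro equalityI subsetI)
    fix c assume "c \<in> ?L"
    then obtain w h x where c: "c = conn (boundary_rel G) `` {w}" "h \<in> hrs G" "End h x \<in> c"
      by (auto simp: boundary_circles_def components_def meets_hr_def elim!: quotientE)
    then have "(w, End h False) \<in> conn (boundary_rel G)"
      using external_conn[OF c(2), of x False] by (auto intro: rtrancl_trans)
    then have "c = ?\<pi> h" using c(1) conn_class_eq[of "boundary_rel G"] by simp
    then show "c \<in> ?R" using c(2) by blast
  next
    fix c assume "c \<in> ?R"
    then obtain h where h: "h \<in> hrs G" "c = ?\<pi> h" by blast
    then have "c \<in> boundary_circles G"
      unfolding boundary_circles_def components_def bpoints_def segs_def
      by (auto intro!: quotientI)
    moreover have "meets_hr G c" using h by (auto simp: meets_hr_def)
    ultimately show "c \<in> ?L" by blast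
  qed
  moreover have "components (hrs G) (boundary_graph G) = ?g ` hrs G"
    by (auto simp: components_def quotient_def)
  moreover have "card (?g ` hrs G) = card (?\<pi> ` hrs G)"
    by (rule card_image_same_kernel) (rule iff)
  ultimately show ?thesis by (simp add: C_bd_def)
qed


section \<open>Cutting edges\<close>

abbreviation hr_points :: "('v, 's) rgraph \<Rightarrow> ('v, 's) bpoint set" where
  "hr_points G \<equiv> {End h x | h x. h \<in> hrs G}"

lemma meets_hr_iff: "meets_hr G c \<longleftrightarrow> c \<inter> hr_points G \<noteq> {}"
  by (auto simp: meets_hr_def)

lemma meets_hr_eq_iff: "meets_hr G c = b \<longleftrightarrow> (c \<inter> hr_points G = {}) = (\<not> b)"
  unfolding meets_hr_iff by blast

lemma hr_points_subset: "hr_points G \<subseteq> bpoints G"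
  by (auto simp: bpoints_def segs_def)

abbreviation circle_of :: "('v, 's) rgraph \<Rightarrow> ('v, 's) bpoint \<Rightarrow> ('v, 's) bpoint set" where
  "circle_of G p \<equiv> conn (boundary_rel G) `` {p}"

lemma boundary_circle_eq_circle_of:
  assumes "c \<in> boundary_circles G" and "p \<in> c"
  shows "c = circle_of G p"
proof -
  obtain w where w: "c = circle_of G w"
    using assms(1) by (auto simp: boundary_circles_def components_def elim!: quotientE)
  then have "(w, p) \<in> conn (boundary_rel G)" using assms(2) by simp
  then show ?thesis using w conn_class_eq[of "boundary_rel G" w p] by simp
qed

lemma cut_simps [simp]:
  "verts (cut C G) = verts G" "edges (cut C G) = edges G - C" "hrs (cut C G) = hrs G \<union> \<Union> C"
  "vert_of (cut C G) = vert_of G" "succ (cut C G) = succ G" "twisted (cut C G) = twisted G"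
  by (simp_all add: cut_def)

lemma segs_cut [simp]: "C \<subseteq> edges G \<Longrightarrow> segs (cut C G) = segs G"
  by (auto simp: segs_def)

lemma edge_segs: "{a, b} \<in> edges G \<Longrightarrow> a \<in> segs G" "{a, b} \<in> edges G \<Longrightarrow> b \<in> segs G"
  unfolding segs_def by blast+

lemma ribbon_graph_finite_segs:
  assumes "ribbon_graph G"
  shows "finite (segs G)"
proof -
  have "finite e" if "e \<in> edges G" for e
    using assms that by (intro card_ge_0_finite) (simp add: ribbon_graph_def)
  then show ?thesis using assms by (simp add: ribbon_graph_def segs_def)
qed

lemma ribbon_graph_cut:
  assumes "ribbon_graph G" and "C \<subseteq> edges G"
  shows "ribbon_graph (cut C G)"
proof -
  have "finite (hrs G \<union> \<Union> C)"
    by (rule finite_subset[OF _ ribbon_graph_finite_segs[OF assms(1)]])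
       (use assms(2) in \<open>auto simp: segs_def\<close>)
  moreover have "e \<inter> (hrs G \<union> \<Union> C) = {}" if "e \<in> edges G - C" for e
  proof -
    have "e \<inter> hrs G = {}" using assms(1) that by (simp add: ribbon_graph_def)
    moreover have "e \<inter> e' = {}" if "e' \<in> C" for e'
    proof -
      have "e \<in> edges G" "e' \<in> edges G" "e \<noteq> e'"
        using that \<open>e \<in> edges G - C\<close> assms(2) by blast+
      then show ?thesis using assms(1) by (simp add: ribbon_graph_def)
    qed
    ultimately have "e \<inter> hrs G = {}" "\<forall>e'\<in>C. e \<inter> e' = {}" by blast+
    then show ?thesis by blast
  qed
  ultimately show ?thesis
    using assms(1) by (simp add: ribbon_graph_def segs_cut[OF assms(2)])
qed

text \<open>The boundaries of \<open>G\<close> and \<open>cut C G\<close> differ only in pieces whose ends lie on segments of the cut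
  edges, and these are HRs of \<open>cut C G\<close>.  So \<open>conn_reaches_iff\<close> applies with the points on HRs of
  \<open>cut C G\<close> as goal, although the two circles of \<open>p\<close> may otherwise be quite different.\<close>

lemma meets_hr_cut_iff:
  assumes "C \<subseteq> edges G"
  shows "meets_hr (cut C G) (circle_of (cut C G) p) \<longleftrightarrow>
           circle_of G p \<inter> hr_points (cut C G) \<noteq> {}"
proof -
  have eq: "vertex_arcs (cut C G) = vertex_arcs G"
    using assms by (simp add: vertex_arcs_def)
  have 1: "x \<in> hr_points (cut C G) \<and> y \<in> hr_points (cut C G)"
    if xy: "(x, y) \<in> boundary_rel (cut C G) - boundary_rel G" for x y
  proof -
    have "edge_sides (cut C G) \<subseteq> edge_sides G" by (auto simp: edge_sides_def)
    then have "(x, y) \<in> external_segments (cut C G)"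
      using xy eq by (auto simp: boundary_rel_def)
    then show ?thesis unfolding external_segments_def by blast
  qed
  have 2: "x \<in> hr_points (cut C G) \<and> y \<in> hr_points (cut C G)"
    if xy: "(x, y) \<in> boundary_rel G - boundary_rel (cut C G)" for x y
  proof -
    have "external_segments G \<subseteq> external_segments (cut C G)"
      by (auto simp: external_segments_def)
    then have "(x, y) \<in> edge_sides G - edge_sides (cut C G)"
      using xy eq by (auto simp: boundary_rel_def)
    then obtain a b u v where "x = End a u" "y = End b v" "{a, b} \<in> C"
      by (auto simp: edge_sides_def)
    then show ?thesis by auto
  qed
  have "(\<exists>m\<in>hr_points (cut C G). (p, m) \<in> conn (boundary_rel (cut C G))) \<longleftrightarrow>
        (\<exists>m\<in>hr_points (cut C G). (p, m) \<in> conn (boundary_rel G))"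
    using 1 2 by (rule conn_reaches_iff)
  then show ?thesis unfolding meets_hr_iff by blast
qed


section \<open>Attaching a half-ribbon\<close>

lemma hr_attached_point: "hr_attached K f p G \<Longrightarrow> p \<in> bpoints K"
  by (erule hr_attached.cases) (auto simp: bpoints_def)

lemma hr_attached_simps:
  assumes "hr_attached K f p G"
  shows "verts G = verts K" "edges G = edges K" "twisted G = twisted K"
    "hrs G = insert f (hrs K)" "f \<notin> segs K" "\<And>t. t \<in> segs K \<Longrightarrow> vert_of G t = vert_of K t"
  using assms by (auto elim!: hr_attached.cases)

lemma hr_attached_segs: "hr_attached K f p G \<Longrightarrow> segs G = insert f (segs K)"
  by (simp add: segs_def hr_attached_simps)

lemma hr_attached_cut:
  assumes "hr_attached K f p G" and C: "C \<subseteq> edges K"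
  shows "hr_attached (cut C K) f p (cut C G)"
  using assms(1)
proof cases
  case (on_arc s)
  have eq: "cut C G = (cut C K)\<lparr>hrs := insert f (hrs (cut C K)),
      vert_of := (vert_of (cut C K))(f := vert_of (cut C K) s),
      succ := (succ (cut C K))(f := succ (cut C K) s, s := f)\<rparr>"
    by (simp add: cut_def on_arc)
  show ?thesis
    unfolding eq on_arc(1) by (rule hr_attached.on_arc) (use on_arc segs_cut[OF C] in simp_all)
next
  case (on_circle v)
  have eq: "cut C G = (cut C K)\<lparr>hrs := insert f (hrs (cut C K)),
      vert_of := (vert_of (cut C K))(f := v), succ := (succ (cut C K))(f := f)\<rparr>"
    by (simp add: cut_def on_circle)
  have "bare (cut C K) v" using on_circle C by (simp add: bare_def)
  then show ?thesis
    unfolding eq on_circle(1) by (rule hr_attached.on_circle) (use on_circle segs_cut[OF C] in simp)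
qed

text \<open>Shrinking the HR \<open>f\<close> back into the point \<open>p\<close> at which it was attached; this is the map that
  identifies the boundary circles before and after attaching \<open>f\<close>.\<close>

definition collapse :: "'s \<Rightarrow> ('v, 's) bpoint \<Rightarrow> ('v, 's) bpoint \<Rightarrow> ('v, 's) bpoint" where
  "collapse f p b = (if b \<in> range (End f) then p else b)"

lemma boundary_rel_End:
  assumes "ribbon_graph G" and "(x, y) \<in> boundary_rel G"
  obtains a b u v where "x = End a u" "y = End b v" "a \<in> segs G" "b \<in> segs G"
proof -
  have succ: "succ G s \<in> segs G" if "s \<in> segs G" for s
    using assms(1) that by (auto simp: ribbon_graph_def dest: bij_betwE)
  consider (arc) s where "s \<in> segs G" "x = End s True" "y = End (succ G s) False"
    | (side) a b u v where "{a, b} \<in> edges G" "x = End a u" "y = End b v"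
    | (external) h where "h \<in> hrs G" "x = End h False" "y = End h True"
    using assms(2)
    by (auto simp: boundary_rel_def vertex_arcs_def edge_sides_def external_segments_def)
  then show thesis
  proof cases
    case arc
    then show thesis using that succ by blast
  next
    case side
    have "a \<in> segs G" "b \<in> segs G" using edge_segs[OF side(1)] .
    then show thesis using that side by blast
  next
    case external
    then have "h \<in> segs G" by (simp add: segs_def)
    then show thesis using that external by blast
  qed
qed

lemma hr_attached_edge_sides: "hr_attached K f p G \<Longrightarrow> edge_sides G = edge_sides K"
  by (simp add: edge_sides_def hr_attached_simps)

lemma hr_attached_external_segments:
  "hr_attached K f p G \<Longrightarrow>
     external_segments G = insert (End f False, End f True) (external_segments K)"
  by (auto simp: external_segments_def hr_attached_simps)

text \<open>The conclusions are the hypotheses of \<open>component_count_transfer\<close> for \<open>\<pi> = collapse f p\<close>.  On an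
  arc, the step from \<open>End s True\<close> to the next segment is replaced by a detour through the two ends of
  \<open>f\<close>, and \<open>\<sigma>\<close> can be the identity.  On a bare vertex, the point \<open>Circle v\<close> is replaced by the
  two ends of \<open>f\<close>, and \<open>\<sigma>\<close> has to choose one of them.\<close>

lemma collapse_boundary:
  assumes K: "ribbon_graph K" and att: "hr_attached K f p G"
  obtains \<sigma> where
    "\<And>x y. (x, y) \<in> boundary_rel G \<Longrightarrow> (collapse f p x, collapse f p y) \<in> conn (boundary_rel K)"
    "\<And>x y. (x, y) \<in> boundary_rel K \<Longrightarrow> (\<sigma> x, \<sigma> y) \<in> conn (boundary_rel G)"
    "\<And>x. x \<in> bpoints G \<Longrightarrow>
       collapse f p x \<in> bpoints K \<and> (x, \<sigma> (collapse f p x)) \<in> conn (boundary_rel G)"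
    "\<And>y. y \<in> bpoints K \<Longrightarrow> \<sigma> y \<in> bpoints G \<and> collapse f p (\<sigma> y) = y"
proof -
  have K_point: "collapse f p x = x \<and> collapse f p y = y" if "(x, y) \<in> boundary_rel K" for x y
    using that hr_attached_simps(5)[OF att]
    by (elim boundary_rel_End[OF K]) (auto simp: collapse_def)
  have f: "collapse f p (End f u) = p" for u by (simp add: collapse_def)
  have ext: "(End f False, End f True) \<in> boundary_rel G"
    using hr_attached_external_segments[OF att] by (simp add: boundary_rel_def)
  have ff: "(End f u, End f u') \<in> conn (boundary_rel G)" for u u'
    by (rule external_conn) (simp add: hr_attached_simps(4)[OF att])
  show thesis
    using att
  proof cases
    case (on_arc s)
    let ?a = "(End s True, End (succ K s) False)"
    have succ: "succ K t \<noteq> f" if "t \<in> segs K" for t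
      using K that on_arc(4) by (auto simp: ribbon_graph_def dest: bij_betwE)
    have sf: "s \<noteq> f" using on_arc by blast
    have G: "vertex_arcs G = (vertex_arcs K - {?a}) \<union>
        {(End s True, End f False), (End f True, End (succ K s) False)}"
      using on_arc sf hr_attached_segs[OF att] by (auto simp: vertex_arcs_def)
    have bare: "bare G v \<longleftrightarrow> bare K v" for v
      using hr_attached_segs[OF att] on_arc sf unfolding bare_def by auto
    have a: "?a \<in> boundary_rel K" using on_arc by (auto simp: boundary_rel_def vertex_arcs_def)
    have K_G: "(x, y) \<in> conn (boundary_rel G)" if "(x, y) \<in> boundary_rel K" for x y
    proof (cases "(x, y) = ?a")
      case True
      have "(End s True, End f False) \<in> boundary_rel G" "(End f True, End (succ K s) False) \<in> boundary_rel G"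
        using G by (simp_all add: boundary_rel_def)
      then have "(End s True, End (succ K s) False) \<in> (boundary_rel G)\<^sup>*"
        using ext by (meson converse_rtrancl_into_rtrancl r_into_rtrancl)
      then show ?thesis using True rtrancl_mono[of "boundary_rel G" "boundary_rel G \<union> (boundary_rel G)\<inverse>"]
        by blast
    next
      case False
      then have "(x, y) \<in> boundary_rel G"
        using that G hr_attached_edge_sides[OF att] hr_attached_external_segments[OF att]
        by (simp add: boundary_rel_def)
      then show ?thesis by (intro conn_step UnI1)
    qed
    show thesis
    proof (rule that[of id])
      fix x y assume "(x, y) \<in> boundary_rel G"
      then consider "(x, y) \<in> boundary_rel K" | "x = End s True" "y = End f False"
        | "x = End f True" "y = End (succ K s) False" | "x = End f False" "y = End f True"
        using G hr_attached_edge_sides[OF att] hr_attached_external_segments[OF att]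
        by (auto simp: boundary_rel_def)
      then show "(collapse f p x, collapse f p y) \<in> conn (boundary_rel K)"
      proof cases
        case 1
        then show ?thesis using K_point[OF 1] by (simp only:) (intro conn_step UnI1)
      next
        case 2
        then have "collapse f p x = p" using K_point[OF a] on_arc(1) by simp
        then show ?thesis using 2 f by (simp only: rtrancl.rtrancl_refl)
      next
        case 3
        have "(collapse f p x, collapse f p y) \<in> boundary_rel K"
          unfolding 3 f using K_point[OF a] a on_arc(1) by simp
        then show ?thesis by (intro conn_step UnI1)
      next
        case 4
        then show ?thesis by (simp add: f)
      qed
    next
      fix x assume x: "x \<in> bpoints G"
      show "collapse f p x \<in> bpoints K \<and> (x, id (collapse f p x)) \<in> conn (boundary_rel G)"
      proof (cases "x \<in> range (End f)")
        case True
        then obtain u where u: "x = End f u" by blast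
        have "(x, End f False) \<in> conn (boundary_rel G)"
          unfolding u by (rule ff)
        moreover have "(End f False, p) \<in> conn (boundary_rel G)"
          using G on_arc(1) by (intro conn_step) (simp add: boundary_rel_def)
        ultimately have "(x, p) \<in> conn (boundary_rel G)" by (rule rtrancl_trans)
        then show ?thesis using u f hr_attached_point[OF att] by simp
      next
        case False
        then show ?thesis using x hr_attached_segs[OF att] by (auto simp: collapse_def bpoints_def bare)
      qed
    next
      fix y assume y: "y \<in> bpoints K"
      have "y \<notin> range (End f)" using y on_arc(4) by (auto simp: bpoints_def)
      then show "id y \<in> bpoints G \<and> collapse f p (id y) = y"
        using y hr_attached_segs[OF att] by (auto simp: collapse_def bpoints_def bare)
    qed (use K_G in simp)
  next
    case (on_circle v)
    have G: "boundary_rel G = boundary_rel K \<union> {(End f True, End f False), (End f False, End f True)}"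
      using on_circle hr_attached_segs[OF att] hr_attached_edge_sides[OF att]
        hr_attached_external_segments[OF att]
      by (auto simp: boundary_rel_def vertex_arcs_def)
    have bare: "bare G w \<longleftrightarrow> bare K w \<and> w \<noteq> v" for w
      using hr_attached_segs[OF att] hr_attached_simps(1,5,6)[OF att] on_circle unfolding bare_def by auto
    \<comment> \<open>Either end of \<open>f\<close> would do, as the external segment and the arc around \<open>v\<close> join them.\<close>
    let ?\<sigma> = "\<lambda>b. if b = Circle v then End f False else b"
    show thesis
    proof (rule that[of ?\<sigma>])
      fix x y assume "(x, y) \<in> boundary_rel G"
      then consider "(x, y) \<in> boundary_rel K" | "x \<in> range (End f)" "y \<in> range (End f)"
        unfolding G by blast
      then show "(collapse f p x, collapse f p y) \<in> conn (boundary_rel K)"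
      proof cases
        case 1
        then show ?thesis using K_point[OF 1] by (simp only:) (intro conn_step UnI1)
      next
        case 2
        then show ?thesis by (simp add: collapse_def)
      qed
    next
      fix x y assume xy: "(x, y) \<in> boundary_rel K"
      then have "(?\<sigma> x, ?\<sigma> y) \<in> boundary_rel G"
        using G by (auto elim: boundary_rel_End[OF K])
      then show "(?\<sigma> x, ?\<sigma> y) \<in> conn (boundary_rel G)" by (intro conn_step UnI1)
    next
      fix x assume x: "x \<in> bpoints G"
      show "collapse f p x \<in> bpoints K \<and> (x, ?\<sigma> (collapse f p x)) \<in> conn (boundary_rel G)"
      proof (cases "x \<in> range (End f)")
        case True
        then obtain u where u: "x = End f u" by blast
        then show ?thesis using f ff hr_attached_point[OF att] on_circle(1) by simp
      next
        case False
        then show ?thesis using x hr_attached_segs[OF att] by (auto simp: collapse_def bpoints_def bare)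
      qed
    next
      fix y assume y: "y \<in> bpoints K"
      then have "y \<notin> range (End f)" using on_circle(4) by (auto simp: bpoints_def)
      then show "?\<sigma> y \<in> bpoints G \<and> collapse f p (?\<sigma> y) = y"
        using y hr_attached_segs[OF att] on_circle(1) by (auto simp: collapse_def bpoints_def bare)
    qed
  qed
qed

lemma hr_attached_circle_count:
  assumes K: "ribbon_graph K" and att: "hr_attached K f p G"
  shows "card {c \<in> boundary_circles G. meets_hr G c = b} =
         card {c \<in> boundary_circles K. (meets_hr K c \<or> p \<in> c) = b}"
proof -
  have hrs: "hrs G = insert f (hrs K)" and f: "f \<notin> hrs K"
    using hr_attached_simps(4,5)[OF att] by (auto simp: segs_def)
  have marks: "insert p (hr_points K) = collapse f p ` hr_points G"
  proof -
    have "hr_points G = range (End f) \<union> hr_points K" unfolding hrs by blast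
    then have "collapse f p ` hr_points G = collapse f p ` range (End f) \<union> collapse f p ` hr_points K"
      by (simp only: image_Un)
    also have "collapse f p ` range (End f) = {p}" by (auto simp: collapse_def)
    also have "collapse f p ` hr_points K = id ` hr_points K"
      using f by (intro image_cong) (auto simp: collapse_def)
    finally show ?thesis by simp
  qed
  obtain \<sigma> where \<sigma>:
    "\<And>x y. (x, y) \<in> boundary_rel G \<Longrightarrow> (collapse f p x, collapse f p y) \<in> conn (boundary_rel K)"
    "\<And>x y. (x, y) \<in> boundary_rel K \<Longrightarrow> (\<sigma> x, \<sigma> y) \<in> conn (boundary_rel G)"
    "\<And>x. x \<in> bpoints G \<Longrightarrow>
       collapse f p x \<in> bpoints K \<and> (x, \<sigma> (collapse f p x)) \<in> conn (boundary_rel G)"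
    "\<And>y. y \<in> bpoints K \<Longrightarrow> \<sigma> y \<in> bpoints G \<and> collapse f p (\<sigma> y) = y"
    using collapse_boundary[OF K att] by blast
  have "card {c \<in> boundary_circles G. (c \<inter> hr_points G = {}) = (\<not> b)} =
        card {c \<in> boundary_circles K. (c \<inter> insert p (hr_points K) = {}) = (\<not> b)}"
    unfolding boundary_circles_def
    by (rule component_count_transfer[where \<pi> = "collapse f p" and \<sigma> = \<sigma>])
       (fact \<sigma>(1) \<sigma>(2) \<sigma>(3) \<sigma>(4) hr_points_subset marks)+
  moreover have "((meets_hr K c \<or> p \<in> c) = b) \<longleftrightarrow> (c \<inter> insert p (hr_points K) = {}) = (\<not> b)" for c
    unfolding meets_hr_iff by blast
  ultimately show ?thesis unfolding meets_hr_eq_iff by simp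
qed

lemma finite_boundary_circles:
  assumes "ribbon_graph G"
  shows "finite (boundary_circles G)"
proof -
  have "finite {End s x | s x. s \<in> segs G}"
    by (rule finite_subset[of _ "(\<lambda>(s, x). End s x) ` (segs G \<times> UNIV)"])
       (use ribbon_graph_finite_segs[OF assms] in auto)
  moreover have "finite {Circle v | v. bare G v}"
    by (rule finite_subset[of _ "Circle ` verts G"])
       (use assms in \<open>auto simp: bare_def ribbon_graph_def\<close>)
  ultimately have "finite (bpoints G)" by (simp add: bpoints_def)
  moreover have "boundary_circles G = circle_of G ` bpoints G"
    by (auto simp: boundary_circles_def components_def quotient_def)
  ultimately show ?thesis by simp
qed

text \<open>The circle of \<open>p\<close> gains a HR and the other circles keep theirs, so a closed face is traded for a
  boundary connected component exactly when the circle of \<open>p\<close> met no HR before.\<close>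

lemma hr_attached_F_int_C_bd:
  assumes K: "ribbon_graph K" and att: "hr_attached K f p G"
  shows "F_int G = F_int K - (if meets_hr K (circle_of K p) then 0 else 1)"
    and "C_bd G = C_bd K + (if meets_hr K (circle_of K p) then 0 else 1)"
proof -
  let ?P = "circle_of K p"
  have P: "?P \<in> boundary_circles K" "p \<in> ?P"
    using hr_attached_point[OF att]
    by (auto simp: boundary_circles_def components_def intro: quotientI)
  then have p: "p \<in> c \<longleftrightarrow> c = ?P" if "c \<in> boundary_circles K" for c
    using boundary_circle_eq_circle_of[OF that] by blast
  have F: "F_int G = card {c \<in> boundary_circles K. (meets_hr K c \<or> p \<in> c) = False}"
    unfolding F_int_def closed_faces_def using hr_attached_circle_count[OF K att, of False] by simp
  have C: "C_bd G = card {c \<in> boundary_circles K. (meets_hr K c \<or> p \<in> c) = True}"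
    unfolding C_bd_eq_circles using hr_attached_circle_count[OF K att, of True] by simp
  have "{c \<in> boundary_circles K. (meets_hr K c \<or> p \<in> c) = False} = closed_faces K - {?P}"
    using p by (auto simp: closed_faces_def)
  then show "F_int G = F_int K - (if meets_hr K ?P then 0 else 1)"
    using P(1) F by (simp add: F_int_def closed_faces_def)
  have "{c \<in> boundary_circles K. (meets_hr K c \<or> p \<in> c) = True} =
        insert ?P {c \<in> boundary_circles K. meets_hr K c}"
    using p P by blast
  then show "C_bd G = C_bd K + (if meets_hr K ?P then 0 else 1)"
    using P(1) C finite_boundary_circles[OF K] by (simp add: C_bd_eq_circles insert_absorb)
qed

lemma hr_attached_k_comp:
  assumes att: "hr_attached K f p G"
  shows "k_comp G = k_comp K"
proof -
  have "vert_of G a = vert_of K a \<and> vert_of G b = vert_of K b" if "{a, b} \<in> edges K" for a b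
    using edge_segs[OF that] hr_attached_simps(6)[OF att] by blast
  then have "{(vert_of G a, vert_of G b) | a b. {a, b} \<in> edges G} =
      {(vert_of K a, vert_of K b) | a b. {a, b} \<in> edges K}"
    unfolding hr_attached_simps(2)[OF att] by metis
  then show ?thesis by (simp add: k_comp_def hr_attached_simps(1)[OF att])
qed

lemma hr_attached_orientable:
  assumes att: "hr_attached K f p G"
  shows "orientable G \<longleftrightarrow> orientable K"
proof -
  have "vert_of G a = vert_of K a \<and> vert_of G b = vert_of K b" if "{a, b} \<in> edges K" for a b
    using edge_segs[OF that] hr_attached_simps(6)[OF att] by blast
  then show ?thesis
    unfolding orientable_def hr_attached_simps(2,3)[OF att] by metis
qed


section \<open>Invariance of the polynomial\<close>

text \<open>Equality of all the numbers from which the summands of the polynomial are computed.  The two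
  graphs may have different types of vertices and segments.\<close>

definition same_counts :: "('v, 's) rgraph \<Rightarrow> ('w, 't) rgraph \<Rightarrow> bool" where
  "same_counts A B \<longleftrightarrow> card (verts A) = card (verts B) \<and> card (edges A) = card (edges B) \<and>
     card (hrs A) = card (hrs B) \<and> k_comp A = k_comp B \<and> t_inv A = t_inv B \<and>
     F_int A = F_int B \<and> C_bd A = C_bd B"

lemma same_counts_rank:
  assumes "same_counts A B"
  shows "rank A = rank B" and "nullity A = nullity B"
  using assms by (simp_all add: same_counts_def rank_def nullity_def)

text \<open>The summand of the polynomial of \<open>G\<close> that belongs to \<open>A\<close>, with \<open>r\<close> standing for
  \<open>rank G\<close>.\<close>

definition subgraph_monomial :: "nat \<Rightarrow> ('v, 's) rgraph \<Rightarrow> zpoly" where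
  "subgraph_monomial r A =
     (Var indX - 1) ^ (r - rank A) * (Var indY - 1) ^ nullity A *
     Var indZ ^ (k_comp A + nullity A - F_int A) * Var indS ^ C_bd A *
     Var indW ^ t_inv A * Var indT ^ card (hrs A)"

lemma R_poly_eq_sum: "R_poly G = (\<Sum>C\<in>Pow (edges G). subgraph_monomial (rank G) (cut C G))"
proof -
  have "inj_on (\<lambda>C. cut C G) (Pow (edges G))"
  proof (rule inj_onI)
    fix C D assume CD: "C \<in> Pow (edges G)" "D \<in> Pow (edges G)" and "cut C G = cut D G"
    have "edges (cut C G) = edges (cut D G)" using \<open>cut C G = cut D G\<close> by (rule arg_cong)
    then have "edges G - C = edges G - D" unfolding cut_simps .
    moreover have "C \<subseteq> edges G" "D \<subseteq> edges G" using CD by simp_all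
    ultimately show "C = D" by blast
  qed
  moreover have "spanning_c_subgraphs G = (\<lambda>C. cut C G) ` Pow (edges G)"
    by (auto simp: spanning_c_subgraphs_def)
  ultimately show ?thesis
    by (simp add: R_poly_def subgraph_monomial_def sum.reindex)
qed

lemma R_eqI:
  assumes G: "same_counts G G'"
    and \<phi>: "bij_betw \<phi> (Pow (edges G)) (Pow (edges G'))"
    and cuts: "\<And>C. C \<subseteq> edges G \<Longrightarrow> same_counts (cut C G) (cut (\<phi> C) G')"
  shows "R G = R G'"
proof -
  have "R_poly G = (\<Sum>C\<in>Pow (edges G). subgraph_monomial (rank G') (cut (\<phi> C) G'))"
    unfolding R_poly_eq_sum same_counts_rank(1)[OF G]
  proof (rule sum.cong[OF refl])
    fix C assume "C \<in> Pow (edges G)"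
    then have "same_counts (cut C G) (cut (\<phi> C) G')" using cuts by blast
    with same_counts_rank[OF this] show "subgraph_monomial (rank G') (cut C G) = subgraph_monomial (rank G') (cut (\<phi> C) G')"
      by (simp add: subgraph_monomial_def same_counts_def)
  qed
  also have "\<dots> = R_poly G'"
    unfolding R_poly_eq_sum by (rule sum.reindex_bij_betw[OF \<phi>])
  finally show ?thesis by (simp add: R_def)
qed

lemma same_counts_attached:
  assumes K: "ribbon_graph K" and att: "hr_attached K f p G" "hr_attached K f q G'"
    and pq: "meets_hr K (circle_of K p) \<longleftrightarrow> meets_hr K (circle_of K q)"
  shows "same_counts G G'"
  unfolding same_counts_def t_inv_def
  using hr_attached_simps(1,2,4)[OF att(1)] hr_attached_simps(1,2,4)[OF att(2)]
    hr_attached_k_comp[OF att(1)] hr_attached_k_comp[OF att(2)]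
    hr_attached_orientable[OF att(1)] hr_attached_orientable[OF att(2)]
    hr_attached_F_int_C_bd[OF K att(1)] hr_attached_F_int_C_bd[OF K att(2)] pq
  by simp

text \<open>The hypothesis on \<open>p\<close> and \<open>q\<close> covers displacements and jumps at once.  It speaks of \<open>H\<close> only,
  and yet controls all cuts of \<open>H\<close>: a HR of \<open>H\<close> remains one in \<open>cut C H\<close>.\<close>

lemma R_reattach:
  assumes H: "ribbon_graph H" and att: "hr_attached H f p G" "hr_attached H f q G'"
    and pq: "circle_of H p = circle_of H q \<or> meets_hr H (circle_of H p) \<and> meets_hr H (circle_of H q)"
  shows "R G = R G'"
proof (rule R_eqI[where \<phi> = id])
  have edges: "edges G = edges H" "edges G' = edges H"
    using hr_attached_simps(2)[OF att(1)] hr_attached_simps(2)[OF att(2)] by simp_all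
  show cuts: "same_counts (cut C G) (cut (id C) G')" if "C \<subseteq> edges G" for C
  proof -
    have C: "C \<subseteq> edges H" using that edges by simp
    have "circle_of H p \<inter> hr_points (cut C H) \<noteq> {} \<longleftrightarrow> circle_of H q \<inter> hr_points (cut C H) \<noteq> {}"
    proof (cases "circle_of H p = circle_of H q")
      case False
      moreover have "hr_points H \<subseteq> hr_points (cut C H)" by auto
      ultimately show ?thesis using pq unfolding meets_hr_iff by blast
    qed simp
    then show ?thesis
      using same_counts_attached[OF ribbon_graph_cut[OF H C] hr_attached_cut[OF att(1) C]
          hr_attached_cut[OF att(2) C]]
      unfolding meets_hr_cut_iff[OF C] by simp
  qed
  show "same_counts G G'" using cuts[of "{}"] by (simp add: cut_def)
  show "bij_betw id (Pow (edges G)) (Pow (edges G'))" by (simp add: edges)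
qed

lemma hr_move_R:
  assumes "hr_move G G'"
  shows "R G = R G'"
proof -
  obtain H f p q c d where H: "ribbon_graph H" "hr_attached H f p G" "hr_attached H f q G'"
    and c: "c \<in> boundary_circles H" "p \<in> c" and d: "d \<in> boundary_circles H" "q \<in> d"
    and cd: "c = d \<or> meets_hr H c \<and> meets_hr H d"
    using assms unfolding hr_move_def displacement_def jump_def by metis
  show ?thesis
    using cd boundary_circle_eq_circle_of[OF c] boundary_circle_eq_circle_of[OF d]
    by (intro R_reattach[OF H]) simp
qed


section \<open>Change of presentation\<close>

text \<open>The data of an isomorphism of presentations, fixed so that they can be transported along cuts:
  the same \<open>f\<close>, \<open>g\<close>, \<open>r\<close> relate \<open>cut C G\<close> to the corresponding cut of \<open>H\<close>.\<close>

locale presentation_change =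
  fixes G :: "('v, 's) rgraph" and H :: "('w, 't) rgraph"
    and f :: "'v \<Rightarrow> 'w" and g :: "'s \<Rightarrow> 't" and r :: "'v \<Rightarrow> bool"
  assumes G: "ribbon_graph G" and H: "ribbon_graph H"
    and f: "bij_betw f (verts G) (verts H)" and g: "bij_betw g (segs G) (segs H)"
    and edges_H: "edges H = (\<lambda>e. g ` e) ` edges G" and hrs_H: "hrs H = g ` hrs G"
    and vert: "s \<in> segs G \<Longrightarrow> vert_of H (g s) = f (vert_of G s)"
    and succ: "s \<in> segs G \<Longrightarrow> if r (vert_of G s) then succ H (g (succ G s)) = g s
                                 else succ H (g s) = g (succ G s)"
    and twisted: "{a, b} \<in> edges G \<Longrightarrow> g ` {a, b} \<in> twisted H \<longleftrightarrow>
         (({a, b} \<in> twisted G) \<noteq> (r (vert_of G a) \<noteq> r (vert_of G b)))"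
begin

lemma inj_g: "inj_on g (segs G)"
  using g by (rule bij_betw_imp_inj_on)

lemma inj_f: "inj_on f (verts G)"
  using f by (rule bij_betw_imp_inj_on)

lemma vert_in: "s \<in> segs G \<Longrightarrow> vert_of G s \<in> verts G"
  using G by (simp add: ribbon_graph_def)

lemma inj_image: "inj_on ((`) g) (edges G)"
proof (rule inj_onI)
  fix e e' assume "e \<in> edges G" "e' \<in> edges G" "g ` e = g ` e'"
  moreover from this have "e \<subseteq> segs G" "e' \<subseteq> segs G" by (auto simp: segs_def)
  ultimately show "e = e'" using inj_on_image_eq_iff[OF inj_g] by blast
qed

lemma edge_H:
  assumes "{a', b'} \<in> edges H"
  obtains a b where "{a, b} \<in> edges G" "a' = g a" "b' = g b"
proof -
  obtain e where e: "e \<in> edges G" "{a', b'} = g ` e" using assms edges_H by blast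
  have "card e = 2" using G e(1) by (simp add: ribbon_graph_def)
  then obtain x y where xy: "e = {x, y}" by (auto simp: card_2_iff)
  then have "a' = g x \<and> b' = g y \<or> a' = g y \<and> b' = g x"
    using e(2) by (auto simp: doubleton_eq_iff)
  moreover have "{x, y} \<in> edges G" "{y, x} \<in> edges G" using e(1) xy by (simp_all add: insert_commute)
  ultimately show thesis using that by blast
qed

lemma edge_G: "{a, b} \<in> edges G \<Longrightarrow> {g a, g b} \<in> edges H"
  unfolding edges_H by (erule rev_image_eqI) simp

text \<open>Reversing the reference direction of a vertex exchanges the first and the last end point of each of
  its segments.\<close>

definition \<pi> :: "('v, 's) bpoint \<Rightarrow> ('w, 't) bpoint" where
  "\<pi> b = (case b of End s x \<Rightarrow> End (g s) (x \<noteq> r (vert_of G s)) | Circle v \<Rightarrow> Circle (f v))"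

lemma \<pi>_simps [simp]:
  "\<pi> (End s x) = End (g s) (x \<noteq> r (vert_of G s))" "\<pi> (Circle v) = Circle (f v)"
  by (simp_all add: \<pi>_def)

lemma bare_iff:
  assumes "v \<in> verts G"
  shows "bare H (f v) \<longleftrightarrow> bare G v"
proof -
  have "segs H = g ` segs G" using g by (simp add: bij_betw_def)
  moreover have "f v \<in> verts H" using bij_betwE[OF f] assms by blast
  moreover have "f (vert_of G s) = f v \<longleftrightarrow> vert_of G s = v" if "s \<in> segs G" for s
    using inj_on_eq_iff[OF inj_f vert_in[OF that] assms] .
  ultimately show ?thesis using assms vert by (simp add: bare_def)
qed

lemma \<pi>_bij: "bij_betw \<pi> (bpoints G) (bpoints H)"
  unfolding bij_betw_def
proof
  show "inj_on \<pi> (bpoints G)"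
  proof (rule inj_onI)
    fix x y assume "x \<in> bpoints G" "y \<in> bpoints G" "\<pi> x = \<pi> y"
    then show "x = y"
      by (auto simp: bpoints_def bare_def dest: inj_onD[OF inj_g] inj_onD[OF inj_f])
  qed
  have segs: "segs H = g ` segs G" using g by (simp add: bij_betw_def)
  have verts: "verts H = f ` verts G" using f by (simp add: bij_betw_def)
  show "\<pi> ` bpoints G = bpoints H"
  proof (intro equalityI subsetI)
    fix y assume "y \<in> \<pi> ` bpoints G"
    then show "y \<in> bpoints H"
      using bare_iff segs by (auto simp: bpoints_def) (auto simp: bare_def)
  next
    fix y assume "y \<in> bpoints H"
    then consider (End) s u where "s \<in> segs G" "y = End (g s) u"
      | (Circle) v where "v \<in> verts G" "bare H (f v)" "y = Circle (f v)"
      unfolding bpoints_def segs bare_def verts by blast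
    then show "y \<in> \<pi> ` bpoints G"
    proof cases
      case End
      then show ?thesis
        by (intro image_eqI[of _ _ "End s (u \<noteq> r (vert_of G s))"]) (auto simp: bpoints_def)
    next
      case Circle
      then show ?thesis
        using bare_iff by (intro image_eqI[of _ _ "Circle v"]) (auto simp: bpoints_def)
    qed
  qed
qed

lemma edge_sides_iff:
  assumes "{a, b} \<in> edges G"
  shows "(\<pi> (End a x), \<pi> (End b y)) \<in> edge_sides H \<longleftrightarrow> (End a x, End b y) \<in> edge_sides G"
proof -
  have "g a \<noteq> g b \<longleftrightarrow> a \<noteq> b"
    using inj_on_eq_iff[OF inj_g edge_segs[OF assms]] by simp
  then show ?thesis
    using twisted[OF assms] edge_G[OF assms] assms by (auto simp: edge_sides_def)
qed

lemma \<pi>_step: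
  assumes "(x, y) \<in> boundary_rel G"
  shows "(\<pi> x, \<pi> y) \<in> boundary_rel H \<union> (boundary_rel H)\<inverse>"
proof -
  have g_in: "g s \<in> segs H" if "s \<in> segs G" for s
    using that bij_betwE[OF g] by blast
  consider (arc) s where "s \<in> segs G" "x = End s True" "y = End (succ G s) False"
    | (side) a b u v where "{a, b} \<in> edges G" "x = End a u" "y = End b v" "(x, y) \<in> edge_sides G"
    | (external) h where "h \<in> hrs G" "x = End h False" "y = End h True"
    using assms
    by (auto simp: boundary_rel_def vertex_arcs_def edge_sides_def external_segments_def)
  then show ?thesis
  proof cases
    case arc
    have vs: "vert_of G (succ G s) = vert_of G s" "succ G s \<in> segs G"
      using G arc(1) by (auto simp: ribbon_graph_def dest: bij_betwE)
    have "(\<pi> x, \<pi> y) \<in> vertex_arcs H \<union> (vertex_arcs H)\<inverse>"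
    proof (cases "r (vert_of G s)")
      case True
      then have "succ H (g (succ G s)) = g s" using succ[OF arc(1)] by simp
      then show ?thesis using g_in[OF vs(2)] True arc vs(1) by (auto simp: vertex_arcs_def)
    next
      case False
      then have "succ H (g s) = g (succ G s)" using succ[OF arc(1)] by simp
      then show ?thesis using g_in[OF arc(1)] False arc vs(1) by (auto simp: vertex_arcs_def)
    qed
    then show ?thesis by (auto simp: boundary_rel_def)
  next
    case side
    then have "(\<pi> x, \<pi> y) \<in> edge_sides H" using edge_sides_iff by blast
    then show ?thesis by (simp add: boundary_rel_def)
  next
    case external
    then have "(\<pi> x, \<pi> y) \<in> external_segments H \<union> (external_segments H)\<inverse>"
      using hrs_H by (auto simp: external_segments_def)
    then show ?thesis by (auto simp: boundary_rel_def)
  qed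
qed

text \<open>Steps are lifted in this existential form because a vertex arc of \<open>H\<close> at a reversed vertex
  runs to the image of the predecessor, not the successor, of the segment in \<open>G\<close>.\<close>

lemma \<pi>_step_lift:
  assumes "(u, v) \<in> boundary_rel H"
  shows "\<exists>x\<in>bpoints G. \<exists>y\<in>bpoints G.
    (x, y) \<in> boundary_rel G \<union> (boundary_rel G)\<inverse> \<and> u = \<pi> x \<and> v = \<pi> y"
proof -
  have E: "End s x \<in> bpoints G" if "s \<in> segs G" for s x using that by (auto simp: bpoints_def)
  have succ_bij: "bij_betw (succ G) (segs G) (segs G)" using G by (simp add: ribbon_graph_def)
  have segs: "segs H = g ` segs G" using g by (simp add: bij_betw_def)
  consider (arc) t where "t \<in> segs H" "u = End t True" "v = End (succ H t) False"
    | (side) a b z w where "{a, b} \<in> edges H" "u = End a z" "v = End b w" "(u, v) \<in> edge_sides H"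
    | (external) h where "h \<in> hrs H" "u = End h False" "v = End h True"
    using assms
    by (auto simp: boundary_rel_def vertex_arcs_def edge_sides_def external_segments_def)
  then show ?thesis
  proof cases
    case arc
    then obtain s where s: "s \<in> segs G" "t = g s" using segs by blast
    show ?thesis
    proof (cases "r (vert_of G s)")
      case False
      have vs: "vert_of G (succ G s) = vert_of G s" "succ G s \<in> segs G"
        using G s(1) by (auto simp: ribbon_graph_def dest: bij_betwE)
      have "succ H t = g (succ G s)" using succ[OF s(1)] False s(2) by simp
      then have "u = \<pi> (End s True)" "v = \<pi> (End (succ G s) False)"
        using arc s(2) False vs by simp_all
      moreover have "(End s True, End (succ G s) False) \<in> boundary_rel G"
        using s(1) by (auto simp: boundary_rel_def vertex_arcs_def)
      ultimately show ?thesis using E s(1) vs(2) by blast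
    next
      case True
      have "s \<in> succ G ` segs G" using succ_bij s(1) by (simp add: bij_betw_def)
      then obtain b where b: "b \<in> segs G" "s = succ G b" by blast
      have vb: "vert_of G s = vert_of G b" using G b by (simp add: ribbon_graph_def)
      have "succ H t = g b" using succ[OF b(1)] True vb b(2) s(2) by simp
      then have "u = \<pi> (End s False)" "v = \<pi> (End b True)"
        using arc s(2) True vb by simp_all
      moreover have "(End b True, End s False) \<in> boundary_rel G"
        using b by (auto simp: boundary_rel_def vertex_arcs_def)
      ultimately show ?thesis using E s(1) b(1) by blast
    qed
  next
    case side
    then obtain a' b' where ab: "{a', b'} \<in> edges G" "a = g a'" "b = g b'" using edge_H by blast
    let ?x = "End a' (z \<noteq> r (vert_of G a'))" and ?y = "End b' (w \<noteq> r (vert_of G b'))"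
    have "u = \<pi> ?x" "v = \<pi> ?y" using side ab by auto
    moreover from this have "(?x, ?y) \<in> boundary_rel G"
      using side(4) edge_sides_iff[OF ab(1)] by (simp add: boundary_rel_def)
    ultimately show ?thesis using E edge_segs[OF ab(1)] by blast
  next
    case external
    then obtain k where k: "k \<in> hrs G" "h = g k" using hrs_H by blast
    let ?x = "End k (r (vert_of G k))" and ?y = "End k (\<not> r (vert_of G k))"
    have "u = \<pi> ?x" "v = \<pi> ?y" using external k by auto
    moreover have "(?x, ?y) \<in> boundary_rel G \<union> (boundary_rel G)\<inverse>"
      using k(1) by (cases "r (vert_of G k)") (auto simp: boundary_rel_def external_segments_def)
    moreover have "k \<in> segs G" using k(1) by (simp add: segs_def)
    ultimately show ?thesis using E by blast
  qed
qed

lemma circle_count: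
  "card {c \<in> boundary_circles G. meets_hr G c = b} = card {c \<in> boundary_circles H. meets_hr H c = b}"
proof -
  have marks: "hr_points H = \<pi> ` hr_points G"
  proof (intro equalityI subsetI)
    fix y assume "y \<in> hr_points H"
    then obtain k u where k: "k \<in> hrs G" "y = End (g k) u" using hrs_H by auto
    then show "y \<in> \<pi> ` hr_points G"
      by (intro image_eqI[of _ _ "End k (u \<noteq> r (vert_of G k))"]) auto
  qed (auto simp: hrs_H)
  have "card {c \<in> boundary_circles G. (c \<inter> hr_points G = {}) = (\<not> b)} =
        card {c \<in> boundary_circles H. (c \<inter> hr_points H = {}) = (\<not> b)}"
    unfolding boundary_circles_def
    by (rule component_count_bij[where \<pi> = \<pi>])
       (fact \<pi>_bij \<pi>_step \<pi>_step_lift hr_points_subset marks)+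
  then show ?thesis unfolding meets_hr_eq_iff .
qed

lemma k_comp_eq: "k_comp G = k_comp H"
proof -
  let ?r = "{(vert_of G a, vert_of G b) | a b. {a, b} \<in> edges G}"
  let ?s = "{(vert_of H a, vert_of H b) | a b. {a, b} \<in> edges H}"
  \<comment> \<open>Without marks, the condition on components is void.\<close>
  have "card {c \<in> components (verts G) ?r. (c \<inter> {} = {}) = True} =
        card {c \<in> components (verts H) ?s. (c \<inter> {} = {}) = True}"
  proof (rule component_count_bij[OF f])
    fix x y assume "(x, y) \<in> ?r"
    then obtain a b where "{a, b} \<in> edges G" "x = vert_of G a" "y = vert_of G b" by blast
    then have "{g a, g b} \<in> edges H" "f x = vert_of H (g a)" "f y = vert_of H (g b)"
      using edge_G vert edge_segs by metis+
    then show "(f x, f y) \<in> ?s \<union> ?s\<inverse>" by blast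
  next
    fix u v assume "(u, v) \<in> ?s"
    then obtain a' b' where "{a', b'} \<in> edges H" "u = vert_of H a'" "v = vert_of H b'" by blast
    then obtain a b where ab: "{a, b} \<in> edges G" "u = vert_of H (g a)" "v = vert_of H (g b)"
      using edge_H by metis
    have "u = f (vert_of G a)" "v = f (vert_of G b)"
      using ab vert edge_segs[OF ab(1)] by simp_all
    then show "\<exists>x\<in>verts G. \<exists>y\<in>verts G. (x, y) \<in> ?r \<union> ?r\<inverse> \<and> u = f x \<and> v = f y"
      using ab(1) vert_in edge_segs[OF ab(1)] by blast
  qed auto
  then show ?thesis by (simp add: k_comp_def)
qed

lemma orientable_iff: "orientable G \<longleftrightarrow> orientable H"
proof
  assume "orientable G"
  then obtain d :: "'v \<Rightarrow> bool" where "\<forall>a b. {a, b} \<in> edges G \<longrightarrow>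
      ({a, b} \<in> twisted G \<longleftrightarrow> d (vert_of G a) \<noteq> d (vert_of G b))"
    unfolding orientable_def by blast
  then have d: "{a, b} \<in> twisted G \<longleftrightarrow> d (vert_of G a) \<noteq> d (vert_of G b)"
    if "{a, b} \<in> edges G" for a b using that by simp
  \<comment> \<open>An orientation of a vertex disc agrees with the reversed reference direction iff it disagrees
    with the original one.\<close>
  let ?d = "\<lambda>w. d (inv_into (verts G) f w) \<noteq> r (inv_into (verts G) f w)"
  have d': "?d (vert_of H (g a)) = (d (vert_of G a) \<noteq> r (vert_of G a))" if "a \<in> segs G" for a
    using vert[OF that] inv_into_f_f[OF inj_f vert_in[OF that]] by simp
  have "{a', b'} \<in> twisted H \<longleftrightarrow> ?d (vert_of H a') \<noteq> ?d (vert_of H b')"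
    if e: "{a', b'} \<in> edges H" for a' b'
  proof -
    obtain a b where ab: "{a, b} \<in> edges G" "a' = g a" "b' = g b" using edge_H[OF e] by blast
    show ?thesis
      unfolding ab(2,3) d'[OF edge_segs(1)[OF ab(1)]] d'[OF edge_segs(2)[OF ab(1)]]
      using twisted[OF ab(1)] d[OF ab(1)] by auto
  qed
  then show "orientable H"
    unfolding orientable_def by (intro exI[of _ ?d] allI impI) simp
next
  assume "orientable H"
  then obtain d :: "'w \<Rightarrow> bool" where "\<forall>a b. {a, b} \<in> edges H \<longrightarrow>
      ({a, b} \<in> twisted H \<longleftrightarrow> d (vert_of H a) \<noteq> d (vert_of H b))"
    unfolding orientable_def by blast
  then have d: "{a, b} \<in> twisted H \<longleftrightarrow> d (vert_of H a) \<noteq> d (vert_of H b)"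
    if "{a, b} \<in> edges H" for a b using that by simp
  let ?d = "\<lambda>v. d (f v) \<noteq> r v"
  have "{a, b} \<in> twisted G \<longleftrightarrow> ?d (vert_of G a) \<noteq> ?d (vert_of G b)" if e: "{a, b} \<in> edges G" for a b
    using twisted[OF e] d[OF edge_G[OF e]] vert edge_segs[OF e] by auto
  then show "orientable G"
    unfolding orientable_def by (intro exI[of _ ?d] allI impI) simp
qed

lemma same_counts: "same_counts G H"
proof -
  have "card (verts G) = card (verts H)" using f by (rule bij_betw_same_card)
  moreover have "card (edges G) = card (edges H)"
    unfolding edges_H using card_image[OF inj_image] by simp
  moreover have "inj_on g (hrs G)"
    by (rule inj_on_subset[OF inj_g]) (simp add: segs_def)
  then have "card (hrs G) = card (hrs H)" unfolding hrs_H by (simp add: card_image)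
  moreover have "F_int G = F_int H" "C_bd G = C_bd H"
    unfolding F_int_def closed_faces_def C_bd_eq_circles
    using circle_count[of False] circle_count[of True] by simp_all
  ultimately show ?thesis by (simp add: same_counts_def k_comp_eq t_inv_def orientable_iff)
qed

lemma presentation_change_cut:
  assumes C: "C \<subseteq> edges G"
  shows "presentation_change (cut C G) (cut ((`) g ` C) H) f g r"
proof -
  have C': "(`) g ` C \<subseteq> edges H" using C edges_H by auto
  have "edges H - (`) g ` C = (`) g ` (edges G - C)"
    unfolding edges_H using inj_on_image_set_diff[OF inj_image _ C, of "edges G"] by simp
  moreover have "hrs H \<union> \<Union> ((`) g ` C) = g ` (hrs G \<union> \<Union> C)"
    unfolding hrs_H by (simp add: image_Un image_Union)
  ultimately show ?thesis
    using ribbon_graph_cut[OF G C] ribbon_graph_cut[OF H C'] f g vert succ twisted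
    by (intro presentation_change.intro) (simp_all add: segs_cut[OF C] segs_cut[OF C'])
qed

lemma R_eq: "R G = R H"
proof (rule R_eqI[where \<phi> = "(`) ((`) g)"])
  have "bij_betw ((`) g) (edges G) (edges H)"
    using inj_image edges_H by (simp add: bij_betw_def)
  then show "bij_betw ((`) ((`) g)) (Pow (edges G)) (Pow (edges H))"
    by (rule bij_betw_Pow)
  show "same_counts (cut C G) (cut ((`) g ` C) H)" if "C \<subseteq> edges G" for C
    using presentation_change_cut[OF that] by (rule presentation_change.same_counts)
qed (rule same_counts)

end

lemma rg_iso_R:
  assumes "rg_iso G H"
  shows "R G = R H"
proof -
  have "\<exists>f g r. presentation_change G H f g r"
    using assms unfolding rg_iso_def
    by (elim conjE ex_forward) (rule presentation_change.intro; simp)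
  then show ?thesis using presentation_change.R_eq by blast
qed

theorem lemma4:
  fixes G :: "('v, 's) rgraph" and G' :: "('w, 't) rgraph"
  assumes "ribbon_graph G" and "ribbon_graph G'" and "hr_equivalent G G'"
  shows "R G = R G'"
proof -
  obtain K where K: "hr_move\<^sup>*\<^sup>* G K" "rg_iso K G'"
    using assms(3) unfolding hr_equivalent_def by blast
  from K(1) have "R G = R K"
  proof (induction rule: rtranclp_induct)
    case (step K L)
    then show ?case using hr_move_R[of K L] by simp
  qed simp
  also have "R K = R G'" using K(2) by (rule rg_iso_R)
  finally show ?thesis .
qed

end
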